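(* Let $\alpha_0,\alpha_1,\alpha_2\in\mathbb{R}$ and let $\mathcal{F}$ be the set of all continuously differentiable functions $f:[0,1]\to\mathbb{R}$ with $\int_0^1 x^kf(x)\,dx=\alpha_k$ for $k=0,1,2$. Put $$\Delta_0:=6\alpha_2-6\alpha_1+\alpha_0,\qquad A:=12(4\alpha_1-\alpha_0-3\alpha_2),\qquad B:=12(3\alpha_2-2\alpha_1).$$ (a) If $\Delta_0>0$, then the optimal range interval of $\mathcal{F}$ is $[A,B]$. (b) If $\Delta_0<0$, then the optimal range interval of $\mathcal{F}$ is $[B,A]$. (c) If $\Delta_0=0$, then $A=B=12(3\alpha_2-2\alpha_1)$, the optimal range interval of $\mathcal{F}$ is the single point $\{12(3\alpha_2-2\alpha_1)\}$, and the optimal length of $\mathcal{F}$ is $L=0$.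
   Context: For a set $\mathcal{F}$ of continuously differentiable functions on $[0,1]$: (1) The optimal range interval of $\mathcal{F}$ is the largest interval $[a,b]$ (with $a\le b$ real, $a=b$ allowed) such that $[a,b]\subseteq \mathrm{Range}(f')$ for every $f\in\mathcal{F}$; that is, $[a,b]$ has this property and contains every other such interval with this property. (2) The optimal length of $\mathcal{F}$ is the largest number $L\ge 0$ such that for every $f\in\mathcal{F}$ there is an interval $[a,b]$ (possibly depending on $f$) with $b-a=L$ and $[a,b]\subseteq \mathrm{Range}(f')$. Here $\mathrm{Range}(f')=f'([0,1])$. *)

theory Defs
  imports "HOL-Analysis.Analysis"
begin

text \<open>
  Functions on the unit interval are represented by total functions of which only the values on
  \<open>{0..1}\<close> matter. Derivatives are therefore taken within \<open>{0..1}\<close>, that is, they are one-sided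
  at the two end points.
\<close>

definition deriv01 :: "(real \<Rightarrow> real) \<Rightarrow> real \<Rightarrow> real" where
  "deriv01 f x = vector_derivative f (at x within {0..1})"

definition C1_01 :: "(real \<Rightarrow> real) set" where
  "C1_01 = {f. f differentiable_on {0..1} \<and> continuous_on {0..1} (deriv01 f)}"

definition deriv_range :: "(real \<Rightarrow> real) \<Rightarrow> real set" where
  "deriv_range f = deriv01 f ` {0..1}"

definition common_range_interval :: "(real \<Rightarrow> real) set \<Rightarrow> real set \<Rightarrow> bool" where
  "common_range_interval F I \<longleftrightarrow>
     (\<exists>a b. a \<le> b \<and> I = {a..b}) \<and> (\<forall>f\<in>F. I \<subseteq> deriv_range f)"

definition optimal_range_interval :: "(real \<Rightarrow> real) set \<Rightarrow> real set \<Rightarrow> bool" where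
  "optimal_range_interval F I \<longleftrightarrow>
     common_range_interval F I \<and> (\<forall>J. common_range_interval F J \<longrightarrow> J \<subseteq> I)"

definition attainable_length :: "(real \<Rightarrow> real) set \<Rightarrow> real \<Rightarrow> bool" where
  "attainable_length F L \<longleftrightarrow>
     0 \<le> L \<and> (\<forall>f\<in>F. \<exists>a b. b - a = L \<and> {a..b} \<subseteq> deriv_range f)"

definition optimal_length :: "(real \<Rightarrow> real) set \<Rightarrow> real \<Rightarrow> bool" where
  "optimal_length F L \<longleftrightarrow>
     attainable_length F L \<and> (\<forall>L'. attainable_length F L' \<longrightarrow> L' \<le> L)"

text \<open>
  The moments are gauge integrals; as the integrands are continuous on \<open>{0..1}\<close>, they exist and
  coincide with the Riemann integrals.
\<close>

definition moment_class :: "real \<Rightarrow> real \<Rightarrow> real \<Rightarrow> (real \<Rightarrow> real) set" where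
  "moment_class \<alpha>\<^sub>0 \<alpha>\<^sub>1 \<alpha>\<^sub>2 =
     {f \<in> C1_01. integral {0..1} (\<lambda>x. x ^ 0 * f x) = \<alpha>\<^sub>0 \<and>
                 integral {0..1} (\<lambda>x. x ^ 1 * f x) = \<alpha>\<^sub>1 \<and>
                 integral {0..1} (\<lambda>x. x ^ 2 * f x) = \<alpha>\<^sub>2}"

end

theory Submission
  imports Defs
begin

text \<open>
  Integrating by parts against \<open>x (1 - x)\<^sup>2\<close> and \<open>x\<^sup>2 (1 - x)\<close>, which vanish at both end points,
  exhibits \<open>A\<close> and \<open>B\<close> as weighted means of \<open>f'\<close>, with weights \<open>12 x (1 - x)\<^sup>2\<close> and
  \<open>12 x\<^sup>2 (1 - x)\<close>. Hence the range of \<open>f'\<close>, an interval, contains the segment between \<open>A\<close> and \<open>B\<close>.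
  Conversely, with \<open>D = B - A\<close>, the two mean value conditions are met by derivatives of the form
  \<open>A - 2 D / n + c x\<^sup>n\<close> and \<open>B + 2 D / n - c (1 - x)\<^sup>n\<close>, where \<open>c\<close> has the sign of \<open>D\<close>. They pass the
  end points \<open>A\<close> and \<open>B\<close>, respectively, by at most \<open>2 \<bar>D\<bar> / n\<close>.
\<close>

section \<open>Calculus of C1 functions on the unit interval\<close>

lemma has_vector_derivative_deriv01:
  assumes "f \<in> C1_01" "x \<in> {0..1}"
  shows "(f has_vector_derivative deriv01 f x) (at x within {0..1})"
  using assms vector_derivative_works[of f "at x within {0..1}"]
  unfolding C1_01_def deriv01_def differentiable_on_def by blast

lemma C1_01_continuous_on:
  assumes "f \<in> C1_01"
  shows "continuous_on {0..1} f"
  using assms differentiable_imp_continuous_on by (auto simp: C1_01_def)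

lemma deriv01_eqI:
  assumes "(f has_real_derivative y) (at x within {0..1})" "x \<in> {0..1}"
  shows "deriv01 f x = y"
  using assms unfolding deriv01_def
  by (intro vector_derivative_within_closed_interval)
     (auto simp: has_real_derivative_iff_has_vector_derivative)

lemma deriv_range_eq_interval:
  assumes "f \<in> C1_01"
  obtains a b where "deriv_range f = {a..b}"
proof -
  have "continuous_on {0..1} (deriv01 f)"
    using assms by (simp add: C1_01_def)
  then show ?thesis
    using that continuous_image_closed_interval[of 0 1 "deriv01 f"]
    by (auto simp: deriv_range_def)
qed

text \<open>The boundary terms vanish with \<open>P\<close>. For quadratic \<open>p\<close> the
  right-hand side is a combination of the three moments, so the weighted integral of the derivative
  is the same for the whole moment class.\<close>

lemma integral_by_parts_01:
  fixes P p :: "real \<Rightarrow> real"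
  assumes f: "f \<in> C1_01"
    and P: "\<And>x. (P has_real_derivative p x) (at x)"
    and p: "continuous_on {0..1} p"
    and "P 0 = 0" "P 1 = 0"
  shows "((\<lambda>x. P x * deriv01 f x) has_integral - integral {0..1} (\<lambda>x. p x * f x)) {0..1}"
proof -
  have "((\<lambda>x. P x * deriv01 f x + p x * f x) has_integral P 1 * f 1 - P 0 * f 0) {0..1}"
  proof (rule fundamental_theorem_of_calculus)
    fix x :: real assume x: "x \<in> {0..1}"
    have "(f has_real_derivative deriv01 f x) (at x within {0..1})"
      using has_vector_derivative_deriv01[OF f x]
      by (simp add: has_real_derivative_iff_has_vector_derivative)
    moreover have "(P has_real_derivative p x) (at x within {0..1})"
      using P has_field_derivative_at_within by blast
    ultimately have "((\<lambda>x. P x * f x) has_real_derivative P x * deriv01 f x + p x * f x)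
        (at x within {0..1})"
      using DERIV_mult'[of P "p x" x "{0..1}" f "deriv01 f x"] by simp
    then show "((\<lambda>x. P x * f x) has_vector_derivative P x * deriv01 f x + p x * f x)
        (at x within {0..1})"
      by (simp add: has_real_derivative_iff_has_vector_derivative)
  qed simp
  moreover have "((\<lambda>x. p x * f x) has_integral integral {0..1} (\<lambda>x. p x * f x)) {0..1}"
    by (intro integrable_integral integrable_continuous_interval continuous_on_mult p
        C1_01_continuous_on f)
  ultimately have "((\<lambda>x. P x * deriv01 f x + p x * f x - p x * f x) has_integral
      P 1 * f 1 - P 0 * f 0 - integral {0..1} (\<lambda>x. p x * f x)) {0..1}"
    by (rule has_integral_diff)
  then show ?thesis
    using assms(4,5) by simp
qed

text \<open>A mean with respect to a probability density lies between the minimum and the maximum of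
  the derivative, and the range is the whole interval between them.\<close>

lemma weighted_mean_in_deriv_range:
  assumes f: "f \<in> C1_01"
    and wg: "((\<lambda>x. w x * deriv01 f x) has_integral c) {0..1}"
    and w: "(w has_integral 1) {0..1}" "\<And>x. x \<in> {0..1} \<Longrightarrow> w x \<ge> 0"
  shows "c \<in> deriv_range f"
proof -
  obtain a b where ab: "deriv_range f = {a..b}"
    using deriv_range_eq_interval[OF f] .
  have g: "deriv01 f x \<in> {a..b}" if "x \<in> {0..1}" for x
    using that ab by (auto simp: deriv_range_def)
  \<comment> \<open>\<open>1 * a\<close> is the integral of \<open>w x * a\<close>, the factor 1
    being the total mass of \<open>w\<close>.\<close>
  have "1 * a \<le> c"
    by (rule has_integral_le[OF has_integral_mult_left[OF w(1)] wg])
       (use g w(2) in \<open>simp add: mult_left_mono\<close>)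
  moreover have "c \<le> 1 * b"
    by (rule has_integral_le[OF wg has_integral_mult_left[OF w(1)]])
       (use g w(2) in \<open>simp add: mult_left_mono\<close>)
  ultimately show ?thesis
    using ab by simp
qed

section \<open>A value of the derivative fixed by the moments\<close>

lemma moment_class_moments:
  assumes "f \<in> moment_class \<alpha>\<^sub>0 \<alpha>\<^sub>1 \<alpha>\<^sub>2"
  shows "((\<lambda>x. (a + b * x + c * x\<^sup>2) * f x) has_integral (a * \<alpha>\<^sub>0 + b * \<alpha>\<^sub>1 + c * \<alpha>\<^sub>2)) {0..1}"
proof -
  have f: "continuous_on {0..1} f"
    using assms C1_01_continuous_on by (auto simp: moment_class_def)
  have m: "((\<lambda>x. x ^ k * f x) has_integral integral {0..1} (\<lambda>x. x ^ k * f x)) {0..1}" for k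
    by (intro integrable_integral integrable_continuous_interval continuous_intros f)
  have "((\<lambda>x. a * (x ^ 0 * f x) + b * (x ^ 1 * f x) + c * (x ^ 2 * f x)) has_integral
      (a * \<alpha>\<^sub>0 + b * \<alpha>\<^sub>1 + c * \<alpha>\<^sub>2)) {0..1}"
    using m[of 0] m[of 1] m[of 2] assms
    by (intro has_integral_add has_integral_mult_right) (simp_all add: moment_class_def)
  then show ?thesis
    by (simp add: algebra_simps)
qed

lemma moment_class_range_A:
  assumes "f \<in> moment_class \<alpha>\<^sub>0 \<alpha>\<^sub>1 \<alpha>\<^sub>2"
  shows "12 * (4 * \<alpha>\<^sub>1 - \<alpha>\<^sub>0 - 3 * \<alpha>\<^sub>2) \<in> deriv_range f"
proof (rule weighted_mean_in_deriv_range)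
  show f: "f \<in> C1_01"
    using assms by (simp add: moment_class_def)
  \<comment> \<open>The derivative of the weight is put in the shape
    \<open>a + b * x + c * x\<^sup>2\<close>, so that \<open>moment_class_moments\<close> evaluates
    its integral against \<open>f\<close>.\<close>
  have "((\<lambda>x::real. 12 * x * (1 - x)\<^sup>2) has_real_derivative 12 + (-48) * x + 36 * x\<^sup>2) (at x)" for x
    by (auto intro!: derivative_eq_intros simp: power2_eq_square algebra_simps)
  then have "((\<lambda>x. 12 * x * (1 - x)\<^sup>2 * deriv01 f x) has_integral
      - integral {0..1} (\<lambda>x. (12 + (-48) * x + 36 * x\<^sup>2) * f x)) {0..1}"
    by (rule integral_by_parts_01[OF f]) (auto intro!: continuous_intros)
  then show "((\<lambda>x. 12 * x * (1 - x)\<^sup>2 * deriv01 f x) has_integral 12 * (4 * \<alpha>\<^sub>1 - \<alpha>\<^sub>0 - 3 * \<alpha>\<^sub>2)) {0..1}"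
    unfolding integral_unique[OF moment_class_moments[OF assms]]
    by (simp add: algebra_simps)
  \<comment> \<open>This antiderivative of the weight increases by 1 from 0 to 1, which accounts for
    the factor 12.\<close>
  have "((\<lambda>x::real. 6 * x\<^sup>2 - 8 * x ^ 3 + 3 * x ^ 4) has_real_derivative 12 * x * (1 - x)\<^sup>2)
      (at x within {0..1})" for x
    by (rule derivative_eq_intros refl)+ (simp add: power2_eq_square power3_eq_cube algebra_simps)
  then have "((\<lambda>x::real. 12 * x * (1 - x)\<^sup>2) has_integral
      (6 * 1\<^sup>2 - 8 * 1 ^ 3 + 3 * 1 ^ 4) - (6 * 0\<^sup>2 - 8 * 0 ^ 3 + 3 * 0 ^ 4)) {0..1}"
    by (intro fundamental_theorem_of_calculus)
       (simp_all flip: has_real_derivative_iff_has_vector_derivative)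
  then show "((\<lambda>x::real. 12 * x * (1 - x)\<^sup>2) has_integral 1) {0..1}"
    by simp
qed auto

lemma closed_segment_subset_deriv_range:
  assumes "f \<in> C1_01" "a \<in> deriv_range f" "b \<in> deriv_range f"
  shows "closed_segment a b \<subseteq> deriv_range f"
  using assms deriv_range_eq_interval[OF assms(1)] by (metis closed_segment_subset convex_real_interval(5))

section \<open>Construction of C1 functions and the reflection of the unit interval\<close>

lemma C1_01_I:
  assumes "\<And>x. x \<in> {0..1} \<Longrightarrow> (f has_real_derivative g x) (at x within {0..1})"
    and "continuous_on {0..1} g"
  shows "f \<in> C1_01" "deriv_range f = g ` {0..1}"
proof -
  have g: "deriv01 f x = g x" if "x \<in> {0..1}" for x
    using that assms(1) deriv01_eqI by blast
  show "f \<in> C1_01"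
    unfolding C1_01_def mem_Collect_eq
  proof
    show "f differentiable_on {0..1}"
      unfolding differentiable_on_def
      using assms(1) field_differentiable_imp_differentiable
      by (metis field_differentiable_def)
    show "continuous_on {0..1} (deriv01 f)"
      by (rule continuous_on_eq[OF assms(2)]) (simp add: g)
  qed
  show "deriv_range f = g ` {0..1}"
    using g by (auto simp: deriv_range_def)
qed

lemma reflect_01_image: "(\<lambda>x::real. 1 - x) ` {0..1} = {0..1}"
  by (auto simp: image_iff intro: bexI[of _ "1 - x" for x])

lemma has_integral_reflect_01:
  fixes f :: "real \<Rightarrow> real"
  assumes "(f has_integral c) {0..1}"
  shows "((\<lambda>x. f (1 - x)) has_integral c) {0..1}"
  using has_integral_affinity[of f c 0 1 "-1" 1] assms reflect_01_image by simp

lemma C1_01_reflect: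
  assumes f: "f \<in> C1_01"
  shows "(\<lambda>x. f (1 - x)) \<in> C1_01" "deriv_range (\<lambda>x. f (1 - x)) = uminus ` deriv_range f"
proof -
  have d: "((\<lambda>x. f (1 - x)) has_real_derivative - deriv01 f (1 - x)) (at x within {0..1})"
    if "x \<in> {0..1}" for x
  proof -
    \<comment> \<open>The chain rule takes the derivative of \<open>f\<close> within the image of
      the inner map, which is again \<open>{0..1}\<close>.\<close>
    have "(f has_real_derivative deriv01 f (1 - x)) (at (1 - x) within (\<lambda>x. 1 - x) ` {0..1})"
      using has_vector_derivative_deriv01[OF f, of "1 - x"] that reflect_01_image
      by (simp add: has_real_derivative_iff_has_vector_derivative)
    moreover have "((\<lambda>x::real. 1 - x) has_real_derivative -1) (at x within {0..1})"
      by (auto intro!: derivative_eq_intros)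
    ultimately show ?thesis
      using DERIV_image_chain[of f "deriv01 f (1 - x)" "\<lambda>x. 1 - x" x "{0..1}" "-1"]
      by (simp add: o_def)
  qed
  have "continuous_on {0..1} (deriv01 f \<circ> (\<lambda>x. 1 - x))"
    using f reflect_01_image
    by (intro continuous_on_compose continuous_on_diff continuous_on_const continuous_on_id)
       (simp add: C1_01_def)
  then have c: "continuous_on {0..1} (\<lambda>x. - deriv01 f (1 - x))"
    by (intro continuous_on_minus) (simp add: o_def)
  show "(\<lambda>x. f (1 - x)) \<in> C1_01"
    using C1_01_I(1)[OF d c] .
  have "(\<lambda>x. - deriv01 f (1 - x)) ` {0..1} = uminus ` deriv01 f ` (\<lambda>x. 1 - x) ` {0..1}"
    by (simp only: image_image)
  then show "deriv_range (\<lambda>x. f (1 - x)) = uminus ` deriv_range f"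
    using C1_01_I(2)[OF d c] reflect_01_image by (simp add: deriv_range_def)
qed

text \<open>The reflection keeps \<Delta> and turns A into -B. As it also negates the range of the
  derivative, each result about A yields one about B.\<close>

lemma moment_class_reflect:
  assumes f: "f \<in> moment_class \<alpha>\<^sub>0 \<alpha>\<^sub>1 \<alpha>\<^sub>2"
  shows "(\<lambda>x. f (1 - x)) \<in> moment_class \<alpha>\<^sub>0 (\<alpha>\<^sub>0 - \<alpha>\<^sub>1) (\<alpha>\<^sub>0 - 2 * \<alpha>\<^sub>1 + \<alpha>\<^sub>2)"
proof -
  have "integral {0..1} (\<lambda>x. (a + b * (1 - x) + c * (1 - x)\<^sup>2) * f (1 - x)) =
      a * \<alpha>\<^sub>0 + b * \<alpha>\<^sub>1 + c * \<alpha>\<^sub>2" for a b c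
    by (rule integral_unique[OF has_integral_reflect_01[OF moment_class_moments[OF f]]])
  \<comment> \<open>The coefficients expand 1, x and \<open>x\<^sup>2\<close> in powers of 1 -
    x.\<close>
  from this[of 1 0 0] this[of 1 "-1" 0] this[of 1 "-2" 1] show ?thesis
    using f C1_01_reflect(1)[of f]
    by (simp add: moment_class_def power2_eq_square algebra_simps)
qed

lemma moment_class_range_B:
  assumes "f \<in> moment_class \<alpha>\<^sub>0 \<alpha>\<^sub>1 \<alpha>\<^sub>2"
  shows "12 * (3 * \<alpha>\<^sub>2 - 2 * \<alpha>\<^sub>1) \<in> deriv_range f"
proof -
  have "- (12 * (3 * \<alpha>\<^sub>2 - 2 * \<alpha>\<^sub>1)) \<in> uminus ` deriv_range f"
    using moment_class_range_A[OF moment_class_reflect[OF assms]] C1_01_reflect(2)[of f] assms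
    by (simp add: moment_class_def algebra_simps)
  then show ?thesis
    unfolding inj_image_mem_iff[OF inj_uminus] .
qed

section \<open>Extremal functions with prescribed moments\<close>

lemma has_integral_monomial_01:
  "((\<lambda>x::real. x ^ n) has_integral 1 / (real n + 1)) {0..1}"
proof -
  have "((\<lambda>x::real. x ^ Suc n / (real n + 1)) has_real_derivative x ^ n) (at x within {0..1})" for x
    using DERIV_cdivide[OF DERIV_pow[of "Suc n" x "{0..1}"], of "real n + 1"] by (simp add: add.commute)
  then have "((\<lambda>x::real. x ^ n) has_integral 1 ^ Suc n / (real n + 1) - 0 ^ Suc n / (real n + 1)) {0..1}"
    by (intro fundamental_theorem_of_calculus)
       (simp_all flip: has_real_derivative_iff_has_vector_derivative)
  then show ?thesis
    by simp
qed

text \<open>The weights \<open>12 * x * (1 - x)\<^sup>2\<close> and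
  \<open>12 * x\<^sup>2 * (1 - x)\<close> integrate \<open>x ^ n\<close> to 24 / ((n+2)(n+3)(n+4))
  and 12 / ((n+3)(n+4)). Requiring the weighted means of a derivative p + s \<open>x ^ n\<close> to
  be A and B = A + 12 \<Delta> determines both p and s.\<close>

lemma moment_class_witness_A:
  assumes "n > 0" and \<Delta>: "\<Delta> = 6 * \<alpha>\<^sub>2 - 6 * \<alpha>\<^sub>1 + \<alpha>\<^sub>0"
  shows "\<exists>f\<in>moment_class \<alpha>\<^sub>0 \<alpha>\<^sub>1 \<alpha>\<^sub>2. deriv_range f =
    (\<lambda>x::real. 12 * (4 * \<alpha>\<^sub>1 - \<alpha>\<^sub>0 - 3 * \<alpha>\<^sub>2) +
      \<Delta> / n * ((real n + 2) * (real n + 3) * (real n + 4) * x ^ n - 24)) ` {0..1}"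
proof -
  define N where "N = real n"
  \<comment> \<open>\<open>p\<close> and \<open>q * (N + 1)\<close> are the coefficients of the
    derivative, \<open>r\<close> is the integral of \<open>q * x ^ (n + 1)\<close>, and the constant
    of integration \<open>k\<close> is chosen to fit the zeroth moment.\<close>
  define u where "u = \<Delta> / N"
  define p where "p = 12 * (4 * \<alpha>\<^sub>1 - \<alpha>\<^sub>0 - 3 * \<alpha>\<^sub>2) - 24 * u"
  define q where "q = \<Delta> * (N + 2) * (N + 3) * (N + 4) / (N * (N + 1))"
  define r where "r = q / (N + 2)"
  define k where "k = \<alpha>\<^sub>0 - p / 2 - r"
  define f where "f = (\<lambda>x. k + p * x + q * x ^ (n + 1))"
  have N: "N > 0"
    using \<open>n > 0\<close> by (simp add: N_def)
  have d: "(f has_real_derivative p + q * (N + 1) * x ^ n) (at x within {0..1})" for x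
    unfolding f_def N_def
    by (rule derivative_eq_intros refl)+ (simp add: algebra_simps del: power_Suc)
  have c: "continuous_on {0..1} (\<lambda>x. p + q * (N + 1) * x ^ n)"
    by (intro continuous_intros)
  have "((\<lambda>x. k * x ^ j + p * x ^ (j + 1) + q * x ^ (j + n + 1)) has_integral
      k * (1 / (real j + 1)) + p * (1 / (real (j + 1) + 1)) + q * (1 / (real (j + n + 1) + 1))) {0..1}"
    for j
    by (intro has_integral_add has_integral_mult_right has_integral_monomial_01)
  then have m: "integral {0..1} (\<lambda>x. x ^ j * f x) =
      k / (real j + 1) + p / (real j + 2) + q / (real j + N + 2)" for j
    by (intro integral_unique) (simp add: f_def N_def algebra_simps power_add)
  have "\<alpha>\<^sub>0 = k + p / 2 + q / (N + 2)"
    by (simp add: k_def r_def)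
  moreover have "\<alpha>\<^sub>1 = k / 2 + p / 3 + q / (N + 3)"
  proof -
    \<comment> \<open>Once the quotient is written through \<open>r\<close>, \<Delta> and
      \<open>u\<close>, the moment identity is linear in these and the \<alpha>'s; likewise for the
      second moment.\<close>
    have "q / (N + 3) = r / 2 + \<Delta> / 2 + 2 * u"
      unfolding q_def r_def u_def using N by (simp add: divide_simps) (simp add: algebra_simps)
    then show ?thesis
      by (simp only: k_def p_def \<Delta>) (simp add: field_simps)
  qed
  moreover have "\<alpha>\<^sub>2 = k / 3 + p / 4 + q / (N + 4)"
  proof -
    have "q / (N + 4) = r / 3 + 2 * \<Delta> / 3 + 2 * u"
      unfolding q_def r_def u_def using N by (simp add: divide_simps) (simp add: algebra_simps)
    then show ?thesis
      by (simp only: k_def p_def \<Delta>) (simp add: field_simps)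
  qed
  ultimately have "f \<in> moment_class \<alpha>\<^sub>0 \<alpha>\<^sub>1 \<alpha>\<^sub>2"
    using m[of 0] m[of 1] m[of 2] C1_01_I(1)[OF d c] by (simp add: moment_class_def add_ac)
  moreover have "deriv_range f = (\<lambda>x::real. 12 * (4 * \<alpha>\<^sub>1 - \<alpha>\<^sub>0 - 3 * \<alpha>\<^sub>2) +
      \<Delta> / N * ((N + 2) * (N + 3) * (N + 4) * x ^ n - 24)) ` {0..1}"
  proof -
    have "p + q * (N + 1) * x ^ n = 12 * (4 * \<alpha>\<^sub>1 - \<alpha>\<^sub>0 - 3 * \<alpha>\<^sub>2) +
        \<Delta> / N * ((N + 2) * (N + 3) * (N + 4) * x ^ n - 24)" for x
      unfolding p_def q_def u_def using N by (simp add: divide_simps) (simp add: algebra_simps)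
    then show ?thesis
      unfolding C1_01_I(2)[OF d c] by simp
  qed
  ultimately show ?thesis
    by (intro bexI[of _ f]) (simp_all add: N_def)
qed

lemma moment_class_witness_B:
  assumes "n > 0" and \<Delta>: "\<Delta> = 6 * \<alpha>\<^sub>2 - 6 * \<alpha>\<^sub>1 + \<alpha>\<^sub>0"
  shows "\<exists>f\<in>moment_class \<alpha>\<^sub>0 \<alpha>\<^sub>1 \<alpha>\<^sub>2. deriv_range f =
    (\<lambda>x::real. 12 * (3 * \<alpha>\<^sub>2 - 2 * \<alpha>\<^sub>1) -
      \<Delta> / n * ((real n + 2) * (real n + 3) * (real n + 4) * x ^ n - 24)) ` {0..1}"
proof -
  \<comment> \<open>\<Delta> is unchanged by the reflection of the moments.\<close>
  have "\<Delta> = 6 * (\<alpha>\<^sub>0 - 2 * \<alpha>\<^sub>1 + \<alpha>\<^sub>2) - 6 * (\<alpha>\<^sub>0 - \<alpha>\<^sub>1) + \<alpha>\<^sub>0"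
    using \<Delta> by simp
  from moment_class_witness_A[OF \<open>n > 0\<close> this]
  obtain f where f: "f \<in> moment_class \<alpha>\<^sub>0 (\<alpha>\<^sub>0 - \<alpha>\<^sub>1) (\<alpha>\<^sub>0 - 2 * \<alpha>\<^sub>1 + \<alpha>\<^sub>2)"
    and r: "deriv_range f =
      (\<lambda>x::real. 12 * (4 * (\<alpha>\<^sub>0 - \<alpha>\<^sub>1) - \<alpha>\<^sub>0 - 3 * (\<alpha>\<^sub>0 - 2 * \<alpha>\<^sub>1 + \<alpha>\<^sub>2)) +
        \<Delta> / n * ((real n + 2) * (real n + 3) * (real n + 4) * x ^ n - 24)) ` {0..1}"
    by blast
  have "deriv_range (\<lambda>x. f (1 - x)) = (\<lambda>x::real. 12 * (3 * \<alpha>\<^sub>2 - 2 * \<alpha>\<^sub>1) -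
      \<Delta> / n * ((real n + 2) * (real n + 3) * (real n + 4) * x ^ n - 24)) ` {0..1}"
    using C1_01_reflect(2)[of f] f
    by (simp add: r image_image moment_class_def algebra_simps)
  then show ?thesis
    using moment_class_reflect[OF f] by (intro bexI) auto
qed

section \<open>Optimality of the interval and of the length\<close>

lemma le_0_if_le_const_over_n:
  fixes a c :: real
  assumes "\<And>n::nat. n > 0 \<Longrightarrow> a \<le> c / n"
  shows "a \<le> 0"
proof (rule LIMSEQ_le_const)
  show "(\<lambda>n. c / real n) \<longlonglongrightarrow> 0"
    by (rule lim_const_over_n)
  show "\<exists>N. \<forall>n\<ge>N. a \<le> c / real n"
    using assms by (intro exI[of _ 1]) auto
qed

text \<open>A common value y lies in the range of every extremal function. Multiplying by \<Delta>
  treats both signs at once: letting n tend to infinity gives \<Delta> (y - A) \<ge> 0 and \<Delta>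
  (B - y) \<ge> 0.\<close>

lemma common_range_interval_moment_class_subset:
  assumes J: "common_range_interval (moment_class \<alpha>\<^sub>0 \<alpha>\<^sub>1 \<alpha>\<^sub>2) J"
  shows "J \<subseteq> closed_segment (12 * (4 * \<alpha>\<^sub>1 - \<alpha>\<^sub>0 - 3 * \<alpha>\<^sub>2)) (12 * (3 * \<alpha>\<^sub>2 - 2 * \<alpha>\<^sub>1))"
proof
  fix y assume "y \<in> J"
  then have y: "y \<in> deriv_range f" if "f \<in> moment_class \<alpha>\<^sub>0 \<alpha>\<^sub>1 \<alpha>\<^sub>2" for f
    using J that by (auto simp: common_range_interval_def)
  define A where "A = 12 * (4 * \<alpha>\<^sub>1 - \<alpha>\<^sub>0 - 3 * \<alpha>\<^sub>2)"
  define B where "B = 12 * (3 * \<alpha>\<^sub>2 - 2 * \<alpha>\<^sub>1)"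
  define \<Delta> where "\<Delta> = 6 * \<alpha>\<^sub>2 - 6 * \<alpha>\<^sub>1 + \<alpha>\<^sub>0"
  define P where "P n x = (real n + 2) * (real n + 3) * (real n + 4) * x ^ n" for n and x :: real
  have P: "P n x \<ge> 0" if "x \<in> {0..1}" for n x
    using that by (simp add: P_def)
  have A: "y \<in> (\<lambda>x. A + \<Delta> / n * (P n x - 24)) ` {0..1}" if "n > 0" for n
    using moment_class_witness_A[OF that \<Delta>_def] y unfolding P_def A_def by metis
  have B: "y \<in> (\<lambda>x. B - \<Delta> / n * (P n x - 24)) ` {0..1}" if "n > 0" for n
    using moment_class_witness_B[OF that \<Delta>_def] y unfolding P_def B_def by metis
  have sq: "- (\<Delta> * (\<Delta> / n * (P n x - 24))) \<le> 24 * \<Delta>\<^sup>2 / n" if "x \<in> {0..1}" for n :: nat and x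
  proof -
    have "0 \<le> \<Delta>\<^sup>2 / n * P n x"
      using P[OF that] by simp
    then show ?thesis
      by (simp add: algebra_simps power2_eq_square diff_divide_distrib)
  qed
  have "- (\<Delta> * (y - A)) \<le> 24 * \<Delta>\<^sup>2 / n" if "n > 0" for n :: nat
  proof -
    obtain x where x: "x \<in> {0..1}" and "y = A + \<Delta> / n * (P n x - 24)"
      using A[OF \<open>n > 0\<close>] by blast
    then have "y - A = \<Delta> / n * (P n x - 24)"
      by linarith
    then show ?thesis
      using sq[OF x, of n] by (simp only:)
  qed
  then have lower: "\<Delta> * (y - A) \<ge> 0"
    using le_0_if_le_const_over_n[of "- (\<Delta> * (y - A))" "24 * \<Delta>\<^sup>2"] by simp
  have "- (\<Delta> * (B - y)) \<le> 24 * \<Delta>\<^sup>2 / n" if "n > 0" for n :: nat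
  proof -
    obtain x where x: "x \<in> {0..1}" and "y = B - \<Delta> / n * (P n x - 24)"
      using B[OF \<open>n > 0\<close>] by blast
    then have "B - y = \<Delta> / n * (P n x - 24)"
      by linarith
    then show ?thesis
      using sq[OF x, of n] by (simp only:)
  qed
  then have upper: "\<Delta> * (B - y) \<ge> 0"
    using le_0_if_le_const_over_n[of "- (\<Delta> * (B - y))" "24 * \<Delta>\<^sup>2"] by simp
  consider "\<Delta> > 0" | "\<Delta> < 0" | "\<Delta> = 0"
    by linarith
  then have "y \<in> closed_segment A B"
  proof cases
    case 1
    then show ?thesis
      using lower upper by (simp add: closed_segment_eq_real_ivl zero_le_mult_iff)
  next
    case 2
    then show ?thesis
      using lower upper by (simp add: closed_segment_eq_real_ivl zero_le_mult_iff)
  next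
    \<comment> \<open>Here \<open>lower\<close> and \<open>upper\<close> say nothing about y, but
      the extremal functions have constant derivative A.\<close>
    case 3
    then have "y = A"
      using A[of 1] by auto
    then show ?thesis
      by simp
  qed
  then show "y \<in> closed_segment (12 * (4 * \<alpha>\<^sub>1 - \<alpha>\<^sub>0 - 3 * \<alpha>\<^sub>2)) (12 * (3 * \<alpha>\<^sub>2 - 2 * \<alpha>\<^sub>1))"
    by (simp only: A_def B_def)
qed

text \<open>The closed segment does not depend on the order of its end points, so one statement
  covers all signs of \<Delta>.\<close>

lemma optimal_range_interval_moment_class:
  "optimal_range_interval (moment_class \<alpha>\<^sub>0 \<alpha>\<^sub>1 \<alpha>\<^sub>2)
    (closed_segment (12 * (4 * \<alpha>\<^sub>1 - \<alpha>\<^sub>0 - 3 * \<alpha>\<^sub>2)) (12 * (3 * \<alpha>\<^sub>2 - 2 * \<alpha>\<^sub>1)))"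
    (is "optimal_range_interval ?F (closed_segment ?A ?B)")
proof -
  have "\<exists>a b. a \<le> b \<and> closed_segment c d = {a..b}" for c d :: real
    by (metis closed_segment_eq_real_ivl linear)
  moreover have "closed_segment ?A ?B \<subseteq> deriv_range f" if "f \<in> ?F" for f
    using that moment_class_range_A[OF that] moment_class_range_B[OF that]
    by (intro closed_segment_subset_deriv_range) (auto simp: moment_class_def)
  ultimately show ?thesis
    using common_range_interval_moment_class_subset
    by (auto simp: optimal_range_interval_def common_range_interval_def[of _ "closed_segment _ _"])
qed

theorem theorem2:
  fixes \<alpha>\<^sub>0 \<alpha>\<^sub>1 \<alpha>\<^sub>2 \<Delta>\<^sub>0 A B :: real and F :: "(real \<Rightarrow> real) set"
  assumes F: "F = moment_class \<alpha>\<^sub>0 \<alpha>\<^sub>1 \<alpha>\<^sub>2"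
    and \<Delta>\<^sub>0: "\<Delta>\<^sub>0 = 6 * \<alpha>\<^sub>2 - 6 * \<alpha>\<^sub>1 + \<alpha>\<^sub>0"
    and A: "A = 12 * (4 * \<alpha>\<^sub>1 - \<alpha>\<^sub>0 - 3 * \<alpha>\<^sub>2)"
    and B: "B = 12 * (3 * \<alpha>\<^sub>2 - 2 * \<alpha>\<^sub>1)"
  shows "(\<Delta>\<^sub>0 > 0 \<longrightarrow> optimal_range_interval F {A..B}) \<and>
         (\<Delta>\<^sub>0 < 0 \<longrightarrow> optimal_range_interval F {B..A}) \<and>
         (\<Delta>\<^sub>0 = 0 \<longrightarrow>
            A = B \<and> B = 12 * (3 * \<alpha>\<^sub>2 - 2 * \<alpha>\<^sub>1) \<and>
            optimal_range_interval F {12 * (3 * \<alpha>\<^sub>2 - 2 * \<alpha>\<^sub>1)} \<and>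
            optimal_length F 0)"
proof -
  have opt: "optimal_range_interval F (closed_segment A B)"
    unfolding F A B by (rule optimal_range_interval_moment_class)
  \<comment> \<open>The sign of \<open>\<Delta>\<^sub>0\<close> decides the order of A and
    B.\<close>
  have AB: "B - A = 12 * \<Delta>\<^sub>0"
    unfolding \<Delta>\<^sub>0 A B by (simp add: algebra_simps)
  have "optimal_range_interval F {A..B}" if "\<Delta>\<^sub>0 > 0"
    using opt AB that by (simp add: closed_segment_eq_real_ivl)
  moreover have "optimal_range_interval F {B..A}" if "\<Delta>\<^sub>0 < 0"
    using opt AB that by (simp add: closed_segment_eq_real_ivl)
  moreover have "A = B \<and> optimal_range_interval F {B} \<and> optimal_length F 0" if zero: "\<Delta>\<^sub>0 = 0"
  proof -
    have "A = B"
      using AB zero by simp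
    then have "optimal_range_interval F {B}"
      using opt by simp
    \<comment> \<open>For \<open>\<Delta>\<^sub>0 = 0\<close> the extremal function has a single
      derivative value, which leaves no room for an interval of positive length.\<close>
    obtain f where f: "f \<in> F" "deriv_range f = {A}"
      using moment_class_witness_A[of 1, OF _ \<Delta>\<^sub>0, folded F A] using zero by (auto simp: image_constant_conv)
    have "attainable_length F 0"
      unfolding attainable_length_def
      using moment_class_range_B[of _ \<alpha>\<^sub>0 \<alpha>\<^sub>1 \<alpha>\<^sub>2] F B by (auto intro!: exI[of _ B])
    moreover have "L \<le> 0" if "attainable_length F L" for L
    proof -
      obtain a b where "b - a = L" "0 \<le> L" and ab: "{a..b} \<subseteq> {A}"
        using \<open>attainable_length F L\<close> f unfolding attainable_length_def by metis
      \<comment> \<open>Since \<open>0 \<le> L\<close>, the interval contains its end points, so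
        both equal A.\<close>
      then have "a \<in> {A}" "b \<in> {A}"
        using subsetD[OF ab, of a] subsetD[OF ab, of b] by simp_all
      then show ?thesis
        using \<open>b - a = L\<close> by simp
    qed
    ultimately show ?thesis
      using \<open>A = B\<close> \<open>optimal_range_interval F {B}\<close> by (simp add: optimal_length_def)
  qed
  ultimately show ?thesis
    using B by blast
qed

end
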